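(* Let $\mathbf e\in\mathbb R^3$ be a unit vector, $\theta\in\mathbb R$, $\tau\in\mathbb R\setminus\{0\}$, $i\ge1$ an integer, $\alpha=2\pi/i$, and $\mathbf z,\mathbf p\in\mathbb R^3$ with $r=|\mathbf p-\mathbf z|>0$ and $(\mathbf p-\mathbf z)\cdot\mathbf e=0$. Let $$g(n,m)=\big(\mathbf Q_{m\theta+n\alpha}\,\big|\,m\tau\mathbf e+(\mathbf I-\mathbf Q_{m\theta+n\alpha})\mathbf z\big),\qquad G=\{g(n,m): m\in\mathbb Z,\ n=-i,\dots,0,\dots,i\}.$$ Let $h$ be the smallest integer greater than $2r^2/\tau^2-1/2$. Let $(n_1,m_1)$ be a minimizer of $$4r^2\sin^2\Big(\frac{m\theta+n\alpha}{2}\Big)+m^2\tau^2$$ over all pairs of integers $(n,m)$ with $n\in\{-i,\dots,i\}$, $m\in\mathbb Z\cap[-h,h]$ and $g(n,m)\ne\mathrm{id}$, and let $(n_2,m_2)$ be a minimizer of the same function over the same set of pairs subject to the additional constraint $m_1n\ne m\,n_1$. Assume that $-\pi/2\le m_1\theta+n_1\alpha\le\pi/2$ and $-\pi/2\le m_2\theta+n_2\alpha\le\pi/2$. Then $g_1=g(n_1,m_1)$ and $g_2=g(n_2,m_2)$ are (nearest neighbor) generators of $G$, i.e. $$G=\{g_1^pg_2^q:(p,q)\in\mathbb Z^2\}.$$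
   Context: $(\mathbf Q|\mathbf c)$ denotes the isometry $\mathbf x\mapsto\mathbf Q\mathbf x+\mathbf c$ of $\mathbb R^3$, the group product being composition. $\mathbf Q_\xi$ denotes the rotation of $\mathbb R^3$ with axis $\mathbf e$ and (right-handed) angle $\xi$. The minimized function equals $|g(n,m)(\mathbf p)-\mathbf p|^2$, the squared distance between the point $\mathbf p$ and its image. *)

theory Defs
  imports "HOL-Analysis.Analysis" "HOL-Algebra.Group"
begin

definition isom :: "real^3^3 \<Rightarrow> real^3 \<Rightarrow> real^3 \<Rightarrow> real^3" where
  "isom Q c = (\<lambda>x. Q *v x + c)"

definition isometry_group :: "(real^3 \<Rightarrow> real^3) monoid" where
  "isometry_group =
     \<lparr>carrier = {isom Q c |Q c. orthogonal_matrix Q}, mult = (\<circ>), one = id\<rparr>"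

(* Rodrigues' formula; it describes a rotation about e only for a unit vector e. *)
definition rot :: "real^3 \<Rightarrow> real \<Rightarrow> real^3^3" where
  "rot e \<xi> = matrix (\<lambda>x. cos \<xi> *\<^sub>R x + sin \<xi> *\<^sub>R cross3 e x
                        + ((1 - cos \<xi>) * (e \<bullet> x)) *\<^sub>R e)"

definition helix_elem ::
    "real^3 \<Rightarrow> real^3 \<Rightarrow> real \<Rightarrow> real \<Rightarrow> real \<Rightarrow> int \<Rightarrow> int \<Rightarrow> real^3 \<Rightarrow> real^3" where
  "helix_elem e z \<theta> \<alpha> \<tau> n m =
     (let Q = rot e (of_int m * \<theta> + of_int n * \<alpha>)
      in isom Q ((of_int m * \<tau>) *\<^sub>R e + (mat 1 - Q) *v z))"

definition disp_sq :: "real \<Rightarrow> real \<Rightarrow> real \<Rightarrow> real \<Rightarrow> int \<times> int \<Rightarrow> real" where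
  "disp_sq r \<theta> \<alpha> \<tau> = (\<lambda>(n, m).
     4 * r\<^sup>2 * (sin ((of_int m * \<theta> + of_int n * \<alpha>) / 2))\<^sup>2 + (of_int m)\<^sup>2 * \<tau>\<^sup>2)"

lemma isom_comp: "isom Q c \<circ> isom R d = isom (Q ** R) (Q *v d + c)"
  by (auto simp: isom_def fun_eq_iff matrix_vector_right_distrib matrix_vector_mul_assoc)

lemma group_isometry_group: "group isometry_group"
proof (rule groupI)
  show "\<one>\<^bsub>isometry_group\<^esub> \<in> carrier isometry_group"
  proof -
    have "id = isom (mat 1) 0" by (auto simp: isom_def)
    then show ?thesis unfolding isometry_group_def using orthogonal_matrix_id by auto
  qed
next
  fix f g assume "f \<in> carrier isometry_group" "g \<in> carrier isometry_group"
  then show "f \<otimes>\<^bsub>isometry_group\<^esub> g \<in> carrier isometry_group"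
    by (auto simp: isometry_group_def isom_comp) (metis orthogonal_matrix_mul)
next
  fix f assume "f \<in> carrier isometry_group"
  then obtain Q c where Q: "orthogonal_matrix Q" "f = isom Q c"
    by (auto simp: isometry_group_def)
  let ?g = "isom (transpose Q) (- (transpose Q *v c))"
  have "?g \<circ> f = id"
    using Q(1) unfolding Q(2) isom_comp
    by (auto simp: isom_def orthogonal_matrix fun_eq_iff)
  moreover have "?g \<in> carrier isometry_group"
    using Q(1) by (auto simp: isometry_group_def orthogonal_matrix_transpose)
  ultimately show "\<exists>g\<in>carrier isometry_group. g \<otimes>\<^bsub>isometry_group\<^esub> f = \<one>\<^bsub>isometry_group\<^esub>"
    by (auto simp: isometry_group_def)
qed (auto simp: isometry_group_def o_assoc)

lemma rot_apply:
  "rot e \<xi> *v x = cos \<xi> *\<^sub>R x + sin \<xi> *\<^sub>R cross3 e x + ((1 - cos \<xi>) * (e \<bullet> x)) *\<^sub>R e"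
proof -
  have "linear (\<lambda>x. cos \<xi> *\<^sub>R x + sin \<xi> *\<^sub>R cross3 e x + ((1 - cos \<xi>) * (e \<bullet> x)) *\<^sub>R e)"
    by (rule linearI) (simp_all add: algebra_simps cross_add_right cross_mult_right inner_add_right)
  then show ?thesis
    unfolding rot_def by (simp add: matrix_works)
qed

lemma rot_axis: "norm e = 1 \<Longrightarrow> rot e \<xi> *v e = e"
  by (simp add: rot_apply norm_eq_1 algebra_simps flip: scaleR_add_left)

lemma rot_perp: "x \<bullet> e = 0 \<Longrightarrow> rot e \<xi> *v x = cos \<xi> *\<^sub>R x + sin \<xi> *\<^sub>R cross3 e x"
  by (simp add: rot_apply inner_commute)

lemma norm_rot:
  assumes "norm e = 1" shows "norm (rot e \<xi> *v x) = norm x"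
proof -
  have e: "e \<bullet> e = 1" using assms by (simp add: norm_eq_1)
  have c: "cross3 e x \<bullet> cross3 e x = x \<bullet> x - (e \<bullet> x)\<^sup>2"
    using norm_cross_dot[of e x] assms by (simp add: power2_norm_eq_inner power_mult_distrib)
  have s: "(sin \<xi>)\<^sup>2 = 1 - (cos \<xi>)\<^sup>2" by (simp add: sin_squared_eq)
  have z: "x \<bullet> cross3 e x = 0" "e \<bullet> cross3 e x = 0"
    by (simp_all add: dot_cross_self)
  have "(rot e \<xi> *v x) \<bullet> (rot e \<xi> *v x) =
      (cos \<xi>)\<^sup>2 * (x \<bullet> x) + (sin \<xi>)\<^sup>2 * (cross3 e x \<bullet> cross3 e x)
      + (1 - cos \<xi>)\<^sup>2 * (e \<bullet> x)\<^sup>2 + 2 * cos \<xi> * (1 - cos \<xi>) * (e \<bullet> x)\<^sup>2"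
    using z e by (simp add: rot_apply inner_add_left inner_add_right inner_commute
        power2_eq_square algebra_simps)
  also have "\<dots> = x \<bullet> x"
    unfolding c s by (simp add: power2_eq_square algebra_simps)
  finally show ?thesis by (simp add: norm_eq_sqrt_inner)
qed

lemma orthogonal_rot: "norm e = 1 \<Longrightarrow> orthogonal_matrix (rot e \<xi>)"
  using orthogonal_transformation_matrix[of "(*v) (rot e \<xi>)"]
  by (simp add: orthogonal_transformation norm_rot)

lemma helix_elem_carrier:
  "norm e = 1 \<Longrightarrow> helix_elem e z \<theta> \<alpha> \<tau> n m \<in> carrier isometry_group"
  by (auto simp: helix_elem_def Let_def isometry_group_def orthogonal_rot)

lemma disp_sq_eq:
  assumes "norm e = 1" "(p - z) \<bullet> e = 0"
  shows "disp_sq (norm (p - z)) \<theta> \<alpha> \<tau> (n, m) = (dist (helix_elem e z \<theta> \<alpha> \<tau> n m p) p)\<^sup>2"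
proof -
  define v where "v = p - z"
  define x where "x = of_int m * \<theta> + of_int n * \<alpha>"
  have e: "e \<bullet> e = 1" using assms by (simp add: norm_eq_1)
  have v: "e \<bullet> v = 0" "v \<bullet> e = 0" using assms by (simp_all add: v_def inner_commute)
  have c: "cross3 e v \<bullet> cross3 e v = v \<bullet> v"
    using norm_cross_dot[of e v] assms(1) v by (simp add: power2_norm_eq_inner)
  have z: "v \<bullet> cross3 e v = 0" "e \<bullet> cross3 e v = 0"
    by (simp_all add: dot_cross_self)
  have sc: "cos x * (cos x * w) + sin x * (sin x * w) = w" for w
    using sin_cos_squared_add3[of x] by (simp flip: mult.assoc distrib_right)
  have "helix_elem e z \<theta> \<alpha> \<tau> n m p - p = rot e x *v v - v + (of_int m * \<tau>) *\<^sub>R e"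
    by (simp add: helix_elem_def Let_def isom_def v_def x_def
        matrix_vector_mult_diff_distrib matrix_vector_mult_diff_rdistrib)
  also have "\<dots> = (cos x - 1) *\<^sub>R v + sin x *\<^sub>R cross3 e v + (of_int m * \<tau>) *\<^sub>R e"
    by (simp add: rot_perp v algebra_simps)
  finally have d: "helix_elem e z \<theta> \<alpha> \<tau> n m p - p
      = (cos x - 1) *\<^sub>R v + sin x *\<^sub>R cross3 e v + (of_int m * \<tau>) *\<^sub>R e" .
  have "(dist (helix_elem e z \<theta> \<alpha> \<tau> n m p) p)\<^sup>2
      = ((cos x - 1)\<^sup>2 + (sin x)\<^sup>2) * (v \<bullet> v) + (of_int m)\<^sup>2 * \<tau>\<^sup>2"
    unfolding dist_norm d power2_norm_eq_inner
    using v z e c by (simp add: sc inner_add_left inner_add_right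
        inner_commute power2_eq_square algebra_simps)
  moreover have "(cos x - 1)\<^sup>2 + (sin x)\<^sup>2 = 4 * (sin (x / 2))\<^sup>2"
  proof -
    have "cos x = 1 - 2 * (sin (x / 2))\<^sup>2" using cos_double_sin[of "x / 2"] by simp
    moreover have "(cos x - 1)\<^sup>2 + (sin x)\<^sup>2 = 2 - 2 * cos x"
      using sin_cos_squared_add[of x] by (simp add: power2_eq_square algebra_simps)
    ultimately show ?thesis by simp
  qed
  ultimately show ?thesis
    by (simp add: disp_sq_def power2_norm_eq_inner flip: v_def x_def)
qed

end

(* The pair (n, m) is sent to the planar lattice point (r X, m tau), X = m theta + n alpha, and
   the minimized function f(n, m) = 4 r^2 sin^2(X / 2) + m^2 tau^2 is at most its squared
   length. Conversely, for |X| <= pi / 2 and (n, m) nonzero, the squared length is below 2 f,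
   because t cos t < sin t. Hence (n1, m1) and (n2, m2) span a sublattice such that every lattice
   point differs from one of its points by a vector of squared length at most
   (|v1|^2 + |v2|^2) / 4 < (f(n1, m1) + f(n2, m2)) / 2 <= f(n2, m2). Minimality then forces this
   difference to act trivially or to lie in the cyclic group generated by g1. *)

theory Submission
  imports Defs
begin

section \<open>Rounding to a lattice\<close>

text \<open>Rounding each coefficient to its nearest integer is not enough: the cross term can push
  the error above this bound when \<open>u\<close> and \<open>v\<close> form an acute angle. The
  corner of the cell has to be chosen jointly.\<close>

lemma exists_close_lattice_point:
  fixes u v :: "'a::real_inner" and a b :: real
  shows "\<exists>(c::int) (d::int).
    (norm ((a - of_int c) *\<^sub>R u + (b - of_int d) *\<^sub>R v))\<^sup>2 \<le> ((norm u)\<^sup>2 + (norm v)\<^sup>2) / 4"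
proof -
  define s t where "s = frac a" and "t = frac b"
  define F where "F = (\<lambda>c d::real. (norm ((s - c) *\<^sub>R u + (t - d) *\<^sub>R v))\<^sup>2)"
  define M where "M = min (min (F 0 0) (F 1 0)) (min (F 0 1) (F 1 1))"
  have s: "0 \<le> s" "0 \<le> 1 - s" and t: "0 \<le> t" "0 \<le> 1 - t"
    using frac_lt_1[of a] frac_lt_1[of b] by (auto simp: s_def t_def)
  have F: "F c d = (s - c)\<^sup>2 * (u \<bullet> u) + 2 * (s - c) * (t - d) * (u \<bullet> v) + (t - d)\<^sup>2 * (v \<bullet> v)"
    for c d
    unfolding F_def power2_norm_eq_inner
    by (simp add: inner_add_left inner_add_right inner_commute[of v u] power2_eq_square)
      (simp add: algebra_simps)
  \<comment> \<open>Rounding the coefficients up independently with probabilities \<open>s\<close> and \<open>t\<close> has mean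
    error zero, so the cross term vanishes in the expected squared error.\<close>
  have "M = (1 - s) * (1 - t) * M + s * (1 - t) * M + (1 - s) * t * M + s * t * M"
    by (simp add: algebra_simps)
  also have "\<dots> \<le> (1 - s) * (1 - t) * F 0 0 + s * (1 - t) * F 1 0 + (1 - s) * t * F 0 1 + s * t * F 1 1"
    by (intro add_mono mult_left_mono mult_nonneg_nonneg s t) (auto simp: M_def)
  also have "\<dots> = s * (1 - s) * (u \<bullet> u) + t * (1 - t) * (v \<bullet> v)"
    by (simp add: F power2_eq_square algebra_simps)
  also have "\<dots> \<le> 1 / 4 * (u \<bullet> u) + 1 / 4 * (v \<bullet> v)"
  proof -
    have "x * (1 - x) \<le> 1 / 4" for x :: real
      using zero_le_power2[of "x - 1 / 2"] by (simp add: power2_eq_square algebra_simps)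
    then show ?thesis by (intro add_mono mult_right_mono) auto
  qed
  finally have "M \<le> ((norm u)\<^sup>2 + (norm v)\<^sup>2) / 4"
    by (simp add: power2_norm_eq_inner)
  moreover have "\<exists>c d::int. M = F (of_int c) (of_int d)"
    unfolding M_def min_def by (metis of_int_0 of_int_1)
  ultimately obtain c d :: int
    where "F (of_int c) (of_int d) \<le> ((norm u)\<^sup>2 + (norm v)\<^sup>2) / 4" by metis
  moreover have "s - of_int c = a - of_int (\<lfloor>a\<rfloor> + c)" "t - of_int d = b - of_int (\<lfloor>b\<rfloor> + d)"
    by (simp_all add: s_def t_def frac_def)
  ultimately show ?thesis unfolding F_def by metis
qed

section \<open>Comparison of sines and angles\<close>

text \<open>By the mean value theorem, sin x = x cos y for some 0 < y < x, and cos is strictly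
  decreasing on [0, pi].\<close>

lemma mult_cos_less_sin:
  fixes x :: real
  assumes "0 < x" "x \<le> pi"
  shows "x * cos x < sin x"
proof -
  have "\<exists>y>0. y < x \<and> sin x - sin 0 = (x - 0) * cos y"
    using assms by (intro MVT2) (auto intro: DERIV_sin)
  then obtain y where "0 < y" "y < x" "sin x = x * cos y" by auto
  moreover have "cos x < cos y"
    using assms calculation by (intro cos_monotone_0_pi) auto
  ultimately show ?thesis using assms by simp
qed

text \<open>The angle window enters here: t = |x| / 2 is at most pi / 4, so cos t is at least sqrt 2
  / 2 and t cos t < sin t applies. The constant 8 is twice the 4 in \<open>disp_sq\<close>.\<close>

lemma square_less_sin_half:
  fixes x :: real
  assumes "\<bar>x\<bar> \<le> pi / 2" "x \<noteq> 0"
  shows "x\<^sup>2 < 8 * (sin (x / 2))\<^sup>2"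
proof -
  define t where "t = \<bar>x\<bar> / 2"
  have t: "0 < t" "t \<le> pi / 4" using assms by (auto simp: t_def)
  have "cos (pi / 4) \<le> cos t" using t by (intro cos_monotone_0_pi_le) auto
  then have "sqrt 2 / 2 \<le> cos t" by (simp add: cos_45)
  then have "t * (sqrt 2 / 2) < sin t"
    using mult_cos_less_sin[of t] t mult_left_mono[of "sqrt 2 / 2" "cos t" t] by linarith
  then have "(t * (sqrt 2 / 2))\<^sup>2 < (sin t)\<^sup>2"
    using t by (intro power_strict_mono) auto
  moreover have "(sin t)\<^sup>2 = (sin (x / 2))\<^sup>2"
    by (cases "x < 0") (auto simp: t_def)
  moreover have "(t * (sqrt 2 / 2))\<^sup>2 = x\<^sup>2 / 8"
    by (simp add: t_def power_mult_distrib power_divide)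
  ultimately show ?thesis by simp
qed

lemma sin_half_sq_le: "4 * (sin (x / 2))\<^sup>2 \<le> (x::real)\<^sup>2"
proof -
  have "(sin (x / 2))\<^sup>2 \<le> (x / 2)\<^sup>2"
    using abs_sin_x_le_abs_x[of "x / 2"] by (simp only: abs_le_square_iff)
  then show ?thesis by (simp add: power_divide)
qed

section \<open>Helical motions as a homomorphic image of Z^2\<close>

text \<open>A rotation preserves the component along \<open>e\<close>, and crossing twice with
  \<open>e\<close> negates the perpendicular part; the addition formulas do the rest.\<close>

lemma rot_add:
  assumes "norm e = 1"
  shows "rot e \<xi> ** rot e \<eta> = rot e (\<xi> + \<eta>)"
proof -
  have e: "e \<bullet> e = 1" using assms by (simp add: norm_eq_1)
  have "(rot e \<xi> ** rot e \<eta>) *v x = rot e (\<xi> + \<eta>) *v x" for x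
  proof -
    have A: "e \<bullet> (rot e \<eta> *v x) = e \<bullet> x"
      by (simp add: rot_apply inner_add_right dot_cross_self e algebra_simps)
    have B: "cross3 e (rot e \<eta> *v x)
        = cos \<eta> *\<^sub>R cross3 e x + sin \<eta> *\<^sub>R ((e \<bullet> x) *\<^sub>R e - x)"
      by (simp add: rot_apply cross_add_right cross_mult_right Lagrange e)
    show ?thesis
      unfolding matrix_vector_mul_assoc[symmetric] rot_apply[of e \<xi>] A B
      by (simp add: rot_apply cos_add sin_add algebra_simps)
  qed
  then show ?thesis by (simp add: matrix_eq)
qed

lemma rot_periodic: "rot e (\<xi> + of_int k * (2 * pi)) = rot e \<xi>"
  using sin_integer_2pi[of "of_int k"] cos_integer_2pi[of "of_int k"]
  by (simp add: rot_def sin_add cos_add mult.commute)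

text \<open>Both rotations fix \<open>e\<close>, so the axial translations add up, and the terms in
  \<open>z\<close> telescope: Q (I - R) z + (I - Q) z = (I - Q R) z. Words in the generators thus
  become integer combinations of index pairs.\<close>

lemma helix_elem_comp:
  assumes "norm e = 1"
  shows "helix_elem e z \<theta> \<alpha> \<tau> n m \<circ> helix_elem e z \<theta> \<alpha> \<tau> n' m'
    = helix_elem e z \<theta> \<alpha> \<tau> (n + n') (m + m')"
proof -
  let ?Q = "rot e (of_int m * \<theta> + of_int n * \<alpha>)"
  let ?R = "rot e (of_int m' * \<theta> + of_int n' * \<alpha>)"
  have "?Q ** ?R = rot e (of_int (m + m') * \<theta> + of_int (n + n') * \<alpha>)"
    unfolding rot_add[OF assms] by (simp add: algebra_simps)
  moreover have "?Q *v ((of_int m' * \<tau>) *\<^sub>R e + (mat 1 - ?R) *v z) + ((of_int m * \<tau>) *\<^sub>R e + (mat 1 - ?Q) *v z)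
      = (of_int (m + m') * \<tau>) *\<^sub>R e + (mat 1 - ?Q ** ?R) *v z"
    using rot_axis[OF assms]
    by (simp add: matrix_vector_right_distrib matrix_vector_mult_diff_distrib
        matrix_vector_mult_diff_rdistrib matrix_vector_mul_assoc matrix_vector_mult_scaleR algebra_simps)
  ultimately show ?thesis by (simp only: helix_elem_def Let_def isom_comp)
qed

lemma helix_elem_zero: "norm e = 1 \<Longrightarrow> helix_elem e z \<theta> \<alpha> \<tau> 0 0 = id"
  by (auto simp: helix_elem_def isom_def rot_apply fun_eq_iff matrix_vector_mult_diff_rdistrib)

lemma helix_elem_int_pow:
  assumes "norm e = 1"
  shows "helix_elem e z \<theta> \<alpha> \<tau> n m [^]\<^bsub>isometry_group\<^esub> (k::int)
    = helix_elem e z \<theta> \<alpha> \<tau> (k * n) (k * m)"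
proof -
  interpret group isometry_group by (rule group_isometry_group)
  let ?g = "helix_elem e z \<theta> \<alpha> \<tau>"
  have nat: "?g n m [^]\<^bsub>isometry_group\<^esub> j = ?g (int j * n) (int j * m)" for j
  proof (induction j)
    case 0
    then show ?case by (simp add: isometry_group_def helix_elem_zero[OF assms])
  next
    case (Suc j)
    have "?g n m [^]\<^bsub>isometry_group\<^esub> Suc j = ?g (int j * n) (int j * m) \<circ> ?g n m"
      using Suc by (simp add: isometry_group_def)
    then show ?case by (simp add: helix_elem_comp[OF assms] algebra_simps)
  qed
  have inv: "inv\<^bsub>isometry_group\<^esub> (?g a b) = ?g (- a) (- b)" for a b
    by (rule inv_equality)
      (simp_all add: helix_elem_carrier[OF assms], simp add: isometry_group_def
        helix_elem_comp[OF assms] helix_elem_zero[OF assms])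
  show ?thesis
    by (simp add: int_pow_def2 nat inv)
qed

text \<open>Since \<open>i\<close> steps make a full turn, any first index can be reduced mod
  \<open>i\<close> into the range allowed in \<open>G\<close>.\<close>

lemma helix_elem_periodic:
  assumes "i \<noteq> 0"
  shows "helix_elem e z \<theta> (2 * pi / of_int i) \<tau> (n + k * i) m
    = helix_elem e z \<theta> (2 * pi / of_int i) \<tau> n m"
proof -
  have "of_int m * \<theta> + of_int (n + k * i) * (2 * pi / of_int i)
      = of_int m * \<theta> + of_int n * (2 * pi / of_int i) + of_int k * (2 * pi)"
    using assms by (simp add: field_simps)
  then show ?thesis by (simp only: helix_elem_def Let_def rot_periodic)
qed

section \<open>Generation by the two minimizers\<close>

theorem mainTheorem3:
  fixes e z p :: "real^3" and \<theta> \<tau> \<alpha> r :: real and i h n1 m1 n2 m2 :: int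
    and g :: "int \<Rightarrow> int \<Rightarrow> real^3 \<Rightarrow> real^3" and g1 g2 :: "real^3 \<Rightarrow> real^3"
    and G :: "(real^3 \<Rightarrow> real^3) set" and admissible :: "int \<times> int \<Rightarrow> bool"
  assumes "norm e = 1"
    and "\<tau> \<noteq> 0"
    and "i \<ge> 1"
    and "\<alpha> = 2 * pi / of_int i"
    and "r = norm (p - z)"
    and "r > 0"
    and "(p - z) \<bullet> e = 0"
    and g_eq: "g = helix_elem e z \<theta> \<alpha> \<tau>"
    and G_eq: "G = {g n m |n m. n \<in> {-i..i}}"
    and h_eq: "h = (LEAST k::int. of_int k > 2 * r\<^sup>2 / \<tau>\<^sup>2 - 1 / 2)"
    and admissible_eq:
      "admissible = (\<lambda>(n, m). n \<in> {-i..i} \<and> m \<in> {-h..h} \<and> g n m \<noteq> id)"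
    and min1: "is_arg_min (disp_sq r \<theta> \<alpha> \<tau>) admissible (n1, m1)"
    and min2: "is_arg_min (disp_sq r \<theta> \<alpha> \<tau>)
                 (\<lambda>(n, m). admissible (n, m) \<and> m1 * n \<noteq> m * n1) (n2, m2)"
    and "- pi / 2 \<le> of_int m1 * \<theta> + of_int n1 * \<alpha>" "of_int m1 * \<theta> + of_int n1 * \<alpha> \<le> pi / 2"
    and "- pi / 2 \<le> of_int m2 * \<theta> + of_int n2 * \<alpha>" "of_int m2 * \<theta> + of_int n2 * \<alpha> \<le> pi / 2"
    and g1_eq: "g1 = g n1 m1"
    and g2_eq: "g2 = g n2 m2"
  shows "G = {(g1 [^]\<^bsub>isometry_group\<^esub> a) \<otimes>\<^bsub>isometry_group\<^esub> (g2 [^]\<^bsub>isometry_group\<^esub> b) |(a::int) (b::int). True}"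
proof -
  let ?f = "disp_sq r \<theta> \<alpha> \<tau>"
  define X where "X = (\<lambda>n m::int. of_int m * \<theta> + of_int n * \<alpha>)"
  \<comment> \<open>This is the squared length of the planar lattice point of (n, m).\<close>
  define E where "E = (\<lambda>n m. r\<^sup>2 * (X n m)\<^sup>2 + (of_int m)\<^sup>2 * \<tau>\<^sup>2)"
  have \<alpha>: "\<alpha> * of_int i = 2 * pi" "\<alpha> > 0" using assms(3,4) by auto
  have window: "\<bar>X n1 m1\<bar> \<le> pi / 2" "\<bar>X n2 m2\<bar> \<le> pi / 2"
    using assms(14-17) unfolding X_def by linarith+
  have f_X: "?f (n, m) = 4 * r\<^sup>2 * (sin (X n m / 2))\<^sup>2 + (of_int m)\<^sup>2 * \<tau>\<^sup>2" for n m
    by (simp add: disp_sq_def X_def)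
  have f_le_E: "?f (n, m) \<le> E n m" for n m
    using mult_left_mono[OF sin_half_sq_le[of "X n m"], of "r\<^sup>2"]
    by (simp add: f_X E_def algebra_simps)
  \<comment> \<open>For a zero angle the sine bound is not strict; then m is nonzero and m^2 tau^2 >
    0 gives strictness.\<close>
  have E_less: "E n m < 2 * ?f (n, m)" if "\<bar>X n m\<bar> \<le> pi / 2" "n \<noteq> 0 \<or> m \<noteq> 0" for n m
  proof (cases "X n m = 0")
    case True
    then have "m \<noteq> 0" using that(2) \<alpha> by (auto simp: X_def)
    then show ?thesis using True assms(2) by (simp add: E_def f_X)
  next
    case False
    have "r\<^sup>2 * (X n m)\<^sup>2 < r\<^sup>2 * (8 * (sin (X n m / 2))\<^sup>2)"
      using square_less_sin_half[OF that(1) False] assms(6) by (intro mult_strict_left_mono) auto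
    moreover have "0 \<le> (of_int m)\<^sup>2 * \<tau>\<^sup>2" by simp
    ultimately show ?thesis by (simp add: E_def f_X add_strict_increasing2)
  qed
  have f_tau: "(of_int m)\<^sup>2 * \<tau>\<^sup>2 \<le> ?f (n, m)" for n m by (simp add: f_X)
  have f_g: "?f (n, m) = (dist (g n m p) p)\<^sup>2" for n m
    unfolding g_eq assms(5) using assms(1,7) by (rule disp_sq_eq)
  have f_not_id: "g n m \<noteq> id" if "?f (n, m) > 0" for n m
    using that by (auto simp: f_g)
  have comp: "g n m \<circ> g n' m' = g (n + n') (m + m')" for n m n' m'
    unfolding g_eq by (rule helix_elem_comp[OF assms(1)])
  have periodic: "g (n + k * i) m = g n m" for n k m
    unfolding g_eq assms(4) using assms(3) by (intro helix_elem_periodic) auto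
  have f_periodic: "?f (n + k * i, m) = ?f (n, m)" for n k m
    by (simp add: f_g periodic)
  have mod_i: "n mod i \<in> {-i..i}" for n
  proof -
    have "0 \<le> n mod i" "n mod i < i" using assms(3) by auto
    then show ?thesis using assms(3) unfolding atLeastAtMost_iff by linarith
  qed
  have G_all: "g n m \<in> G" for n m
  proof -
    have "g n m = g (n mod i) m"
      using periodic[of "n mod i" "n div i" m] by simp
    then show ?thesis unfolding G_eq using mod_i by blast
  qed
  have word: "(g1 [^]\<^bsub>isometry_group\<^esub> a) \<otimes>\<^bsub>isometry_group\<^esub> (g2 [^]\<^bsub>isometry_group\<^esub> b)
      = g (a * n1 + b * n2) (a * m1 + b * m2)" for a b :: int
    using comp unfolding g1_eq g2_eq g_eq helix_elem_int_pow[OF assms(1)]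
    by (simp add: isometry_group_def)

  have adm1: "n1 \<in> {-i..i}" "m1 \<in> {-h..h}" "g n1 m1 \<noteq> id"
    and min1: "\<And>n m. admissible (n, m) \<Longrightarrow> ?f (n1, m1) \<le> ?f (n, m)"
    using min1 by (auto simp: is_arg_min_def admissible_eq not_less)
  have adm2: "n2 \<in> {-i..i}" "m2 \<in> {-h..h}" "g n2 m2 \<noteq> id" and D: "m1 * n2 \<noteq> m2 * n1"
    and min2: "\<And>n m. admissible (n, m) \<Longrightarrow> m1 * n \<noteq> m * n1 \<Longrightarrow> ?f (n2, m2) \<le> ?f (n, m)"
    using min2 by (auto simp: is_arg_min_def admissible_eq not_less)
  have f12: "?f (n1, m1) \<le> ?f (n2, m2)"
    using adm2 by (intro min1) (auto simp: admissible_eq)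
  \<comment> \<open>If h < 1, only m1 = m2 = 0 could be admissible, contradicting
    \<open>D\<close>.\<close>
  have h1: "h \<ge> 1" using adm1(2) adm2(2) D by (cases "m1 = 0"; cases "m2 = 0") auto
  have h: "of_int h > 2 * r\<^sup>2 / \<tau>\<^sup>2 - 1 / 2"
  proof -
    let ?c = "2 * r\<^sup>2 / \<tau>\<^sup>2 - 1 / 2"
    \<comment> \<open>The integers are not well-ordered, so the value of \<open>LEAST\<close> has to
      be exhibited.\<close>
    have "h = \<lfloor>?c\<rfloor> + 1"
      unfolding h_eq
    proof (rule Least_equality)
      show "of_int (\<lfloor>?c\<rfloor> + 1) > ?c" by linarith
    next
      fix k :: int
      assume "of_int k > ?c"
      then show "\<lfloor>?c\<rfloor> + 1 \<le> k" by (simp only: add1_zle_eq floor_less_iff)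
    qed
    then show ?thesis by linarith
  qed
  \<comment> \<open>The choice of h is made for this: it gives m^2 < 2 h + 2, which is at most (h +
    1)^2 once h >= 1. The bound 4 r^2 + tau^2 dominates f on all pairs (n, 1).\<close>
  have small_m: "\<bar>m\<bar> \<le> h" if "(of_int m)\<^sup>2 * \<tau>\<^sup>2 \<le> 4 * r\<^sup>2 + \<tau>\<^sup>2" for m :: int
  proof -
    have "(of_int m)\<^sup>2 \<le> 4 * r\<^sup>2 / \<tau>\<^sup>2 + 1"
      using that assms(2) by (simp add: field_simps)
    then have "(of_int m)\<^sup>2 < 2 * real_of_int h + 2" using h by simp
    then have "real_of_int (m\<^sup>2) < real_of_int (2 * h + 2)" by simp
    then have "m\<^sup>2 < 2 * h + 2" by linarith
    moreover have "1 * 1 \<le> h * h" using h1 by (intro mult_mono) auto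
    ultimately have "m\<^sup>2 < (h + 1)\<^sup>2" by (simp add: power2_eq_square algebra_simps)
    then have "\<bar>m\<bar>\<^sup>2 < (h + 1)\<^sup>2" by simp
    then have "\<bar>m\<bar> < h + 1"
      using h1 power_less_imp_less_base[of "\<bar>m\<bar>" 2 "h + 1"] by linarith
    then show ?thesis by linarith
  qed
  have f01: "?f (n, 1) \<le> 4 * r\<^sup>2 + \<tau>\<^sup>2" for n
    using mult_left_mono[OF abs_square_le_1[THEN iffD2, OF abs_sin_le_one[of "X n 1 / 2"]], of "4 * r\<^sup>2"]
    by (simp add: f_X)
  have "?f (0, 1) > 0" using assms(2) by (simp add: f_X add_nonneg_pos)
  then have adm01: "admissible (0, 1)"
    using h1 assms(3) f_not_id by (auto simp: admissible_eq)
  \<comment> \<open>If \<open>m1 \<noteq> 0\<close>, then \<open>(n1 \<plusminus> i, m1)\<close> names the same element as \<open>(n1, m1)\<close> but passes the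
    non-collinearity test, so the two minima coincide.\<close>
  have eq12: "?f (n2, m2) = ?f (n1, m1)" if "m1 \<noteq> 0"
  proof -
    obtain k :: int where k: "k \<noteq> 0" "n1 + k * i \<in> {-i..i}"
    proof (cases "n1 \<le> 0")
      case True
      then show ?thesis using that[of 1] adm1 by auto
    next
      case False
      then show ?thesis using that[of "-1"] adm1 by auto
    qed
    have "?f (n2, m2) \<le> ?f (n1 + k * i, m1)"
      using k adm1 that assms(3) by (intro min2) (auto simp: admissible_eq periodic)
    then show ?thesis using f12 by (simp add: f_periodic)
  qed
  \<comment> \<open>The competitor is (0, 1). It passes the non-collinearity test if m1 = 0;
    otherwise \<open>eq12\<close> reduces the claim to the first minimum.\<close>
  have f2_le: "?f (n2, m2) \<le> 4 * r\<^sup>2 + \<tau>\<^sup>2"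
  proof (cases "m1 = 0")
    case True
    then have "n1 \<noteq> 0" using D by auto
    then have "?f (n2, m2) \<le> ?f (0, 1)" using True by (intro min2 adm01) auto
    then show ?thesis using f01[of 0] by linarith
  next
    case False
    then show ?thesis using min1[OF adm01] f01[of 0] eq12 by linarith
  qed
  \<comment> \<open>If |n1| >= 2, then (1, 0) would beat (n1, 0), because the half angle t is at
    most pi / 4, where sin increases.\<close>
  have n1: "n1 = 1 \<or> n1 = - 1" if "m1 = 0"
  proof (rule ccontr)
    assume not1: "\<not> ?thesis"
    have n1: "\<bar>n1\<bar> \<ge> 2" using D that not1 by (cases "n1 = 0") auto
    define t where "t = \<bar>of_int n1\<bar> * \<alpha> / 2"
    have t: "t \<le> pi / 4"
      using window(1) that \<alpha>(2) by (simp add: t_def X_def abs_mult mult.commute)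
    have lt: "\<alpha> / 2 < t"
      using n1 \<alpha>(2) by (auto simp: t_def abs_if)
    have "sin (\<alpha> / 2) < sin t"
      using t lt \<alpha> pi_gt_zero by (intro sin_monotone_2pi) auto
    moreover have pos: "sin (\<alpha> / 2) > 0"
      using t lt \<alpha> pi_gt_zero by (intro sin_gt_zero) auto
    ultimately have "(sin (\<alpha> / 2))\<^sup>2 < (sin t)\<^sup>2" by (intro power_strict_mono) auto
    moreover have "(sin t)\<^sup>2 = (sin (X n1 m1 / 2))\<^sup>2"
      using that by (cases "n1 < 0") (auto simp: t_def X_def)
    ultimately have "?f (1, 0) < ?f (n1, m1)"
      using that assms(6) by (simp add: f_X X_def)
    moreover have "?f (1, 0) > 0"
      using pos assms(6) by (simp add: f_X X_def)
    then have "admissible (1, 0)"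
      using h1 assms(3) f_not_id by (auto simp: admissible_eq)
    then have "?f (n1, m1) \<le> ?f (1, 0)" by (rule min1)
    ultimately show False by simp
  qed

  have "\<exists>a b::int. g n m = g (a * n1 + b * n2) (a * m1 + b * m2)" for n m
  proof -
    define u v :: "real \<times> real" where "u = (r * X n1 m1, of_int m1 * \<tau>)"
      and "v = (r * X n2 m2, of_int m2 * \<tau>)"
    define \<Delta> where "\<Delta> = real_of_int (m1 * n2 - m2 * n1)"
    \<comment> \<open>Cramer's rule: the coordinates of (n, m) in the basis (n1, m1), (n2,
      m2).\<close>
    define s t where "s = of_int (m * n2 - n * m2) / \<Delta>" and "t = of_int (m1 * n - m * n1) / \<Delta>"
    have \<Delta>: "\<Delta> \<noteq> 0" using D unfolding \<Delta>_def by (simp only: of_int_eq_0_iff)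
    have "\<Delta> * of_int n = \<Delta> * (s * of_int n1 + t * of_int n2)"
      "\<Delta> * of_int m = \<Delta> * (s * of_int m1 + t * of_int m2)"
      using \<Delta> by (simp_all add: s_def t_def distrib_left) (simp_all add: \<Delta>_def algebra_simps)
    then have st: "of_int n = s * of_int n1 + t * of_int n2" "of_int m = s * of_int m1 + t * of_int m2"
      using \<Delta> by simp_all
    obtain a b :: int where ab: "(norm ((s - of_int a) *\<^sub>R u + (t - of_int b) *\<^sub>R v))\<^sup>2
        \<le> ((norm u)\<^sup>2 + (norm v)\<^sup>2) / 4"
      using exists_close_lattice_point by blast
    define n' m' where "n' = n - (a * n1 + b * n2)" and "m' = m - (a * m1 + b * m2)"
    have "(s - of_int a) *\<^sub>R u + (t - of_int b) *\<^sub>R v = (r * X n' m', of_int m' * \<tau>)"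
      by (simp add: u_def v_def n'_def m'_def X_def st algebra_simps)
    then have "E n' m' \<le> (E n1 m1 + E n2 m2) / 4"
      using ab by (simp add: u_def v_def norm_Pair power_mult_distrib E_def)
    moreover have "E n1 m1 < 2 * ?f (n1, m1)"
      using window(1) D by (intro E_less) auto
    moreover have "E n2 m2 < 2 * ?f (n2, m2)"
      using window(2) D by (intro E_less) auto
    ultimately have "E n' m' < (?f (n1, m1) + ?f (n2, m2)) / 2" by argo
    then have small: "?f (n', m') < ?f (n2, m2)"
      using f_le_E[of n' m'] f12 by argo
    have n: "n = (a * n1 + b * n2) + n'" "m = (a * m1 + b * m2) + m'"
      by (simp_all add: n'_def m'_def)
    consider "g n' m' = id" | "m1 = 0" "m' = 0" | "m1 \<noteq> 0 \<or> m' \<noteq> 0" "g n' m' \<noteq> id" by blast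
    then show ?thesis
    proof cases
      case 1
      then have "g n m = g (a * n1 + b * n2) (a * m1 + b * m2)"
        unfolding n comp[symmetric] by simp
      then show ?thesis by blast
    next
      case 2
      \<comment> \<open>As n1 * n1 = 1, the remainder n' equals (n' * n1) * n1 and is absorbed by
        the first generator.\<close>
      then have "n = (a + n' * n1) * n1 + b * n2" "m = (a + n' * n1) * m1 + b * m2"
        using n1 n by (auto simp: algebra_simps)
      then show ?thesis by metis
    next
      case 3
      \<comment> \<open>Reduction mod i keeps the element and f but may change collinearity with
        (n1, m1). For m1 = 0 the test only asks that m' be nonzero; for m1 nonzero,
        \<open>eq12\<close> lets the unconstrained first minimality suffice. Either way
        \<open>small\<close> is contradicted.\<close>
      define N where "N = n' mod i"
      have N: "g N m' = g n' m'"
        using periodic[of N "n' div i" m'] by (simp add: N_def)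
      have "\<bar>m'\<bar> \<le> h"
        using small f2_le f_tau[of m' n'] by (intro small_m) linarith
      then have adm: "admissible (N, m')"
        using 3 N mod_i[of n'] by (auto simp: admissible_eq N_def)
      have fN: "?f (N, m') = ?f (n', m')" by (simp add: f_g N)
      have "?f (n2, m2) \<le> ?f (N, m')"
      proof (cases "m1 = 0")
        case True
        then show ?thesis using 3 D by (intro min2 adm) auto
      next
        case False
        then show ?thesis using min1[OF adm] eq12 by simp
      qed
      then show ?thesis using small fN by simp
    qed
  qed
  then show ?thesis
    unfolding word using G_all by (auto simp: G_eq)
qed

end
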